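(* Let $n\in\mathbb{N}$, let $\mathcal{J}$ be a partition of $\{1,\dots,n\}$ into nonempty subsets, let $S_1,\dots,S_n$ be Polish spaces, let $Z_{1:n}=(Z_1,\dots,Z_n)$ be a random element of $S_1\times\cdots\times S_n$, and let $\mathcal{G}_{1:n}$ be a set of $n$-tuples $g_{1:n}=(g_1,\dots,g_n)$ of Borel-measurable functions $g_k:S_k\to\mathbb{R}$. Then there exists a sequence $Z_{1:n}^{*}=(Z_1^*,\dots,Z_n^* )$ of random variables with the following properties: 1. For every $k\in\{1,\dots,n\}$, the distributions of $Z_k^*$ and $Z_k$ are the same. 2. For every $J\in\mathcal{J}$, $Z_J^*=(Z_j^* )_{j\in J}$ is an independent sequence. 3. For every $(a,b,t)\in\mathbb{R}^3$, $$\mathbb{P}\Big(\sup_{g_{1:n}\in\mathcal{G}_{1:n}}(aA_{Z_{1:n}}+b\mu_{Z_{1:n}})g_{1:n}\geq t\Big)\leq \sum_{J\in\mathcal{J}}\Big(\mathbb{P}\Big(\sup_{g_J\in\mathcal{G}_J}(aA_{Z_J^*}+b\mu_{Z_J})g_J\geq t\Big)+\sum_{k\in J}\beta_{Z_J}(1,k)\Big).$$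
   Context: All random variables live on a probability space $(\Omega,\mathcal{E},\mathbb{P})$, which by convention is rich enough to support all the random variables whose existence is asserted. $\mathbb{N}=\{1,2,\dots\}$. For $J\subset\{1,\dots,n\}$ and a tuple $c_{1:n}$, $c_J:=(c_j)_{j\in J}$; $\mathcal{G}_J:=\{g_J: g_{1:n}\in\mathcal{G}_{1:n}\}$ is the projection of $\mathcal{G}_{1:n}$ onto the coordinates in $J$. For a nonempty finite index set $J$, a random element $Z_J=(Z_j)_{j\in J}$ of $\prod_{j\in J}S_j$ and a tuple $g_J=(g_j)_{j\in J}$ of Borel functions $g_j:S_j\to\mathbb{R}$, $$A_{Z_J}g_J:=\frac{1}{|J|}\sum_{j\in J}g_j(Z_j),\qquad \mu_{Z_J}g_J:=\frac{1}{|J|}\sum_{j\in J}\int_{S_j}g_j(z)\,\mathbb{P}_{Z_j}(dz),$$ where $\mathbb{P}_{Z_j}$ is the law of $Z_j$ (the second average is considered only where it makes sense), and $(aA_{Z_J}+b\mu_{Z_J})g_J:=aA_{Z_J}g_J+b\mu_{Z_J}g_J$; similarly with $Z_J^*$ in place of $Z_J$ in the empirical mean. $\beta$-mixing coefficients: for sub-sigma-algebras $\mathcal{E}_1,\mathcal{E}_2$ of $\mathcal{E}$, $$\beta(\mathcal{E}_1,\mathcal{E}_2):=\mathbb{E}\Big[\operatorname{ess\,sup}_{E_1\in\mathcal{E}_1}|\mathbb{P}(E_1)-\mathbb{P}[E_1|\mathcal{E}_2]|\Big],$$ where $\operatorname{ess\,sup}$ denotes the essential supremum of a family of random variables. For $J\subset\mathbb{N}$,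 a random sequence $Z_J$, and $(m,l)\in\mathbb{N}\times\mathbb{N}$, $$\beta_{Z_J}(m,l):=\beta\big(\sigma(Z_{J\cap[1,l-m]}),\sigma(Z_{J\cap\{l\}})\big),$$ with the convention that $Z_\emptyset:=\emptyset$ (so $\sigma(Z_\emptyset)$ is trivial). *)

theory Defs
  imports "HOL-Probability.Probability"
begin

definition polish_topology :: "'a topology \<Rightarrow> bool" where
  "polish_topology X \<longleftrightarrow> completely_metrizable_space X \<and> separable_space X"

definition borel_of :: "'a topology \<Rightarrow> 'a measure" where
  "borel_of X = sigma (topspace X) {U. openin X U}"

(* The integral is allowed to be infinite; it is meaningful as soon as one of the two parts is
   finite (see ext_integral_eq_integral below for the integrable case). *)
definition ext_integral :: "'a measure \<Rightarrow> ('a \<Rightarrow> real) \<Rightarrow> ereal" where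
  "ext_integral M f = enn2ereal (\<integral>\<^sup>+ x. ennreal (f x) \<partial>M) - enn2ereal (\<integral>\<^sup>+ x. ennreal (- f x) \<partial>M)"

lemma ext_integral_eq_integral:
  assumes "integrable M f"
  shows "ext_integral M f = ereal (integral\<^sup>L M f)"
proof -
  have fin: "(\<integral>\<^sup>+ x. ennreal (f x) \<partial>M) \<noteq> \<infinity>" "(\<integral>\<^sup>+ x. ennreal (- f x) \<partial>M) \<noteq> \<infinity>"
    using assms by (simp_all add: real_integrable_def)
  have *: "enn2ereal x = ereal (enn2real x)" if "x \<noteq> \<infinity>" for x :: ennreal
    using that by (cases x) (auto simp: enn2ereal_ennreal)
  show ?thesis
    using fin unfolding ext_integral_def real_lebesgue_integral_def[OF assms] by (simp add: *)
qed

text \<open>Essential supremum of a family of \<open>[0, \<infinity>]\<close>-valued random variables: the almost surely least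
  random variable that dominates every member of the family almost surely.\<close>

definition is_ess_Sup :: "'w measure \<Rightarrow> ('w \<Rightarrow> ennreal) set \<Rightarrow> ('w \<Rightarrow> ennreal) \<Rightarrow> bool" where
  "is_ess_Sup M \<X> Y \<longleftrightarrow>
     Y \<in> borel_measurable M \<and>
     (\<forall>X\<in>\<X>. AE \<omega> in M. X \<omega> \<le> Y \<omega>) \<and>
     (\<forall>Y'\<in>borel_measurable M. (\<forall>X\<in>\<X>. AE \<omega> in M. X \<omega> \<le> Y' \<omega>) \<longrightarrow> (AE \<omega> in M. Y \<omega> \<le> Y' \<omega>))"

definition ess_Sup :: "'w measure \<Rightarrow> ('w \<Rightarrow> ennreal) set \<Rightarrow> 'w \<Rightarrow> ennreal" where
  "ess_Sup M \<X> = (SOME Y. is_ess_Sup M \<X> Y)"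

lemma is_ess_Sup_ess_Sup:
  assumes M: "finite_measure M"
    and meas: "\<And>X. X \<in> \<X> \<Longrightarrow> X \<in> borel_measurable M"
    and bnd: "\<And>X. X \<in> \<X> \<Longrightarrow> AE \<omega> in M. X \<omega> \<le> ennreal c"
  shows "is_ess_Sup M \<X> (ess_Sup M \<X>)"
proof -
  interpret finite_measure M by fact
  define K where "K = {C. countable C \<and> C \<subseteq> \<X>}"
  define F where "F C \<omega> = (SUP X\<in>C. X \<omega>)" for C :: "('a \<Rightarrow> ennreal) set" and \<omega>
  define s where "s = (SUP C\<in>K. \<integral>\<^sup>+ \<omega>. F C \<omega> \<partial>M)"
  have F_meas: "F C \<in> borel_measurable M" if "C \<in> K" for C
    unfolding F_def using that meas by (intro borel_measurable_SUP) (auto simp: K_def)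
  have "{} \<in> K" by (simp add: K_def)
  then have "(\<lambda>C. \<integral>\<^sup>+ \<omega>. F C \<omega> \<partial>M) ` K \<noteq> {}" by blast
  from ennreal_Sup_countable_SUP[OF this]
  obtain I :: "nat \<Rightarrow> ennreal"
    where I: "range I \<subseteq> (\<lambda>C. \<integral>\<^sup>+ \<omega>. F C \<omega> \<partial>M) ` K" "s = (SUP i. I i)"
    unfolding s_def by (elim exE conjE) metis
  have "\<exists>C. C \<in> K \<and> I i = (\<integral>\<^sup>+ \<omega>. F C \<omega> \<partial>M)" for i
    using subsetD[OF I(1) rangeI[of I i]] by (elim imageE) metis
  then obtain C where C: "\<And>i. C i \<in> K" "\<And>i. I i = (\<integral>\<^sup>+ \<omega>. F (C i) \<omega> \<partial>M)"
    by metis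
  define D where "D = (\<Union>i. C i)"
  have D: "D \<in> K" using C(1) by (auto simp: D_def K_def)
  have "s \<le> (\<integral>\<^sup>+ \<omega>. F D \<omega> \<partial>M)"
    unfolding I(2) C(2) by (intro SUP_least nn_integral_mono) (auto simp: F_def D_def intro!: SUP_subset_mono)
  have le_s: "(\<integral>\<^sup>+ \<omega>. F C \<omega> \<partial>M) \<le> s" if "C \<in> K" for C
    unfolding s_def using that by (rule SUP_upper)
  have AE_D: "AE \<omega> in M. F D \<omega> \<le> Y \<omega>" if "\<forall>X\<in>\<X>. AE \<omega> in M. X \<omega> \<le> Y \<omega>" for Y
  proof -
    have "AE \<omega> in M. \<forall>X\<in>D. X \<omega> \<le> Y \<omega>"
      using D that by (intro AE_ball_countable[THEN iffD2]) (auto simp: K_def)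
    then show ?thesis by eventually_elim (auto simp: F_def intro!: SUP_least)
  qed
  have "(\<integral>\<^sup>+ \<omega>. F D \<omega> \<partial>M) \<le> (\<integral>\<^sup>+ \<omega>. ennreal c \<partial>M)"
    using bnd by (intro nn_integral_mono_AE AE_D) auto
  then have fin: "(\<integral>\<^sup>+ \<omega>. F D \<omega> \<partial>M) \<noteq> \<infinity>"
    by (auto simp: ennreal_mult_eq_top_iff top_unique)
  have "is_ess_Sup M \<X> (F D)"
    unfolding is_ess_Sup_def
  proof (intro conjI ballI impI)
    show "F D \<in> borel_measurable M" using D by (rule F_meas)
  next
    fix X assume X: "X \<in> \<X>"
    have ins: "insert X D \<in> K" using X D by (auto simp: K_def)
    have "(\<integral>\<^sup>+ \<omega>. F (insert X D) \<omega> \<partial>M) \<le> (\<integral>\<^sup>+ \<omega>. F D \<omega> \<partial>M)"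
      using le_s[OF ins] \<open>s \<le> _\<close> by (rule order_trans)
    moreover have "AE \<omega> in M. F D \<omega> \<le> F (insert X D) \<omega>"
      by (auto simp: F_def intro!: SUP_subset_mono)
    ultimately have eq: "AE \<omega> in M. F (insert X D) \<omega> \<le> F D \<omega>"
      using nn_integral_less[OF F_meas[OF D] F_meas[OF ins] fin] by (meson not_less)
    have "X \<omega> \<le> F (insert X D) \<omega>" for \<omega>
      by (auto simp: F_def intro!: SUP_upper)
    then show "AE \<omega> in M. X \<omega> \<le> F D \<omega>"
      using eq by (auto elim!: eventually_mono intro: order_trans)
  next
    fix Y' assume "Y' \<in> borel_measurable M" and *: "\<forall>X\<in>\<X>. AE \<omega> in M. X \<omega> \<le> Y' \<omega>"
    show "AE \<omega> in M. F D \<omega> \<le> Y' \<omega>" using * by (rule AE_D)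
  qed
  then show ?thesis unfolding ess_Sup_def by (rule someI[of "is_ess_Sup M \<X>"])
qed

text \<open>Sub-sigma-algebras are represented as measures \<open>\<E>\<^sub>1\<close>, \<open>\<E>\<^sub>2\<close> with
  \<open>subalgebra M \<E>\<^sub>i\<close>; only their sets matter.\<close>

definition beta_coeff :: "'w measure \<Rightarrow> 'w measure \<Rightarrow> 'w measure \<Rightarrow> ennreal" where
  "beta_coeff M \<E>\<^sub>1 \<E>\<^sub>2 =
     (\<integral>\<^sup>+ \<omega>. ess_Sup M ((\<lambda>E \<omega>. ennreal \<bar>measure M E - real_cond_exp M \<E>\<^sub>2 (indicator E) \<omega>\<bar>) ` sets \<E>\<^sub>1) \<omega> \<partial>M)"

text \<open>The sigma-algebra generated by \<open>Z\<^sub>I\<close>; it is trivial for \<open>I = {}\<close>.\<close>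

definition sigma_seq ::
  "'w measure \<Rightarrow> (nat \<Rightarrow> 'a topology) \<Rightarrow> (nat \<Rightarrow> 'w \<Rightarrow> 'a) \<Rightarrow> nat set \<Rightarrow> 'w measure" where
  "sigma_seq M S Z I =
     vimage_algebra (space M) (\<lambda>\<omega>. \<lambda>i\<in>I. Z i \<omega>) (\<Pi>\<^sub>M i\<in>I. borel_of (S i))"

text \<open>For \<open>l \<le> m\<close> the interval \<open>{1..l - m}\<close> is empty, also with truncated subtraction.\<close>

definition beta_seq ::
  "'w measure \<Rightarrow> (nat \<Rightarrow> 'a topology) \<Rightarrow> (nat \<Rightarrow> 'w \<Rightarrow> 'a) \<Rightarrow> nat set \<Rightarrow> nat \<Rightarrow> nat \<Rightarrow> ennreal" where
  "beta_seq M S Z J m l =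
     beta_coeff M (sigma_seq M S Z (J \<inter> {1..l - m})) (sigma_seq M S Z (J \<inter> {l}))"

definition emp_mean :: "(nat \<Rightarrow> 'w \<Rightarrow> 'a) \<Rightarrow> nat set \<Rightarrow> (nat \<Rightarrow> 'a \<Rightarrow> real) \<Rightarrow> 'w \<Rightarrow> real" where
  "emp_mean Z J g \<omega> = (\<Sum>j\<in>J. g j (Z j \<omega>)) / real (card J)"

definition avg_mean ::
  "'w measure \<Rightarrow> (nat \<Rightarrow> 'a topology) \<Rightarrow> (nat \<Rightarrow> 'w \<Rightarrow> 'a) \<Rightarrow> nat set \<Rightarrow> (nat \<Rightarrow> 'a \<Rightarrow> real) \<Rightarrow> ereal" where
  "avg_mean M S Z J g =
     (\<Sum>j\<in>J. ext_integral (distr M (borel_of (S j)) (Z j)) (g j)) / ereal (real (card J))"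

definition proj_tuples :: "nat set \<Rightarrow> (nat \<Rightarrow> 'b) set \<Rightarrow> (nat \<Rightarrow> 'b) set" where
  "proj_tuples J \<G> = (\<lambda>g. restrict g J) ` \<G>"

text \<open>The event \<open>sup\<^bsub>g \<in> \<G>\<^esub> (a A\<^bsub>Y\<^esub> + b \<mu>\<^bsub>Z\<^esub>) g \<ge> t\<close>: the empirical mean is that of a sequence \<open>Y\<close>
  on \<open>N\<close>, the laws are those of \<open>Z\<close> on \<open>M\<close>. For \<open>b = 0\<close> the term \<open>b \<mu>\<^bsub>Z\<^esub> g\<close> vanishes even if the
  integrals are infinite or undefined.\<close>

definition sup_event ::
  "'v measure \<Rightarrow> (nat \<Rightarrow> 'v \<Rightarrow> 'a) \<Rightarrow> 'w measure \<Rightarrow> (nat \<Rightarrow> 'a topology) \<Rightarrow> (nat \<Rightarrow> 'w \<Rightarrow> 'a) \<Rightarrow>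
   nat set \<Rightarrow> (nat \<Rightarrow> 'a \<Rightarrow> real) set \<Rightarrow> real \<Rightarrow> real \<Rightarrow> real \<Rightarrow> 'v set" where
  "sup_event N Y M S Z J \<G> a b t =
     {\<omega>\<in>space N. (SUP g\<in>\<G>. ereal (a * emp_mean Y J g \<omega>) + ereal b * avg_mean M S Z J g) \<ge> ereal t}"

text \<open>The suprema may range over uncountable sets, so the events need not be measurable. Their
  probabilities are outer probabilities, \<^const>\<open>outer_measure_of\<close>, which agree with the
  probability on measurable events.

  A probability space \<open>N\<close> with a measure-preserving map \<open>\<pi>\<close> onto \<open>M\<close> is an enlargement of \<open>M\<close>
  that carries every random variable \<open>X\<close> of \<open>M\<close> as \<open>X \<circ> \<pi>\<close>. This renders the convention that the
  underlying space is rich enough.\<close>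

definition enlarges :: "'v measure \<Rightarrow> ('v \<Rightarrow> 'w) \<Rightarrow> 'w measure \<Rightarrow> bool" where
  "enlarges N \<pi> M \<longleftrightarrow> prob_space N \<and> \<pi> \<in> N \<rightarrow>\<^sub>M M \<and> distr N M \<pi> = M"

end

theory Submission
  imports Defs
begin

text \<open>No coupling is needed. Take \<open>Z\<^sup>*\<close> fully independent, on the product of the given space with the
  product of the marginal laws. The supremum over \<open>{1..n}\<close> is at most a convex combination of the
  suprema over the blocks, so it suffices to treat one block \<open>J\<close>. There only laws matter: the law of
  \<open>Z\<^sub>J\<close> exceeds the product of its marginals by at most the sum of the \<open>\<beta>\<close>-coefficients, one
  coordinate being split off at a time. For a pair \<open>(X, Y)\<close> this is immediate on a union of
  rectangles \<open>A\<^sub>i \<times> B\<^sub>i\<close> with disjoint \<open>B\<^sub>i\<close>, by integrating the essential supremum over the events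
  \<open>Y \<in> B\<^sub>i\<close>, and such unions approximate every measurable set.\<close>

section \<open>Approximation in product sigma-algebras by unions of rectangles\<close>

text \<open>The point is that a single approximating set serves both measures, which is what allows
  passing from one law to the other later. The approximable sets are closed under the sigma-algebra
  operations: complements leave the symmetric difference unchanged, and countable unions are first
  truncated to finite ones.\<close>

lemma approx_algebra_two_measures:
  fixes R1 R2 :: "'b measure"
  assumes R1: "finite_measure R1" and R2: "finite_measure R2"
    and sets1: "sets R1 = sigma_sets \<Omega> \<A>" and sets2: "sets R2 = sigma_sets \<Omega> \<A>"
    and alg: "algebra \<Omega> \<A>"
    and C: "C \<in> sigma_sets \<Omega> \<A>" and "0 < e"
  shows "\<exists>A\<in>\<A>. measure R1 (sym_diff C A) < e \<and> measure R2 (sym_diff C A) < e"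
  using C \<open>0 < e\<close>
proof (induction arbitrary: e)
  case (Basic a)
  then show ?case by (intro bexI[of _ a]) auto
next
  case Empty
  interpret algebra \<Omega> \<A> by fact
  show ?case using \<open>0 < e\<close> by (intro bexI[of _ "{}"]) auto
next
  case (Compl a)
  interpret algebra \<Omega> \<A> by fact
  from Compl.IH[OF \<open>0 < e\<close>] obtain A where A: "A \<in> \<A>"
    "measure R1 (sym_diff a A) < e" "measure R2 (sym_diff a A) < e" by blast
  have "a \<subseteq> \<Omega>" using Compl.hyps sigma_sets_into_sp[OF space_closed] by blast
  moreover have "A \<subseteq> \<Omega>" using A space_closed by blast
  ultimately have "sym_diff (\<Omega> - a) (\<Omega> - A) = sym_diff a A" by blast
  with A show ?case by (intro bexI[of _ "\<Omega> - A"]) auto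
next
  case (Union a)
  interpret algebra \<Omega> \<A> by fact
  interpret R1: finite_measure R1 by fact
  interpret R2: finite_measure R2 by fact
  have a1: "\<And>i. a i \<in> sets R1" and a2: "\<And>i. a i \<in> sets R2"
    using Union.hyps by (simp_all add: sets1 sets2)
  \<comment> \<open>\<open>D n\<close> is what the first \<open>n\<close> sets miss of the union. It
    decreases to the empty set, so one \<open>n\<close> makes it small for both measures.\<close>
  define D where "D n = (\<Union>i. a i) - (\<Union>i<n. a i)" for n
  have D: "decseq D" "(\<Inter>n. D n) = {}"
    by (auto simp: D_def decseq_def)
  have "(\<lambda>n. measure R1 (D n)) \<longlonglongrightarrow> measure R1 (\<Inter>n. D n)"
    using a1 by (intro R1.finite_Lim_measure_decseq D) (auto simp: D_def)
  moreover have "(\<lambda>n. measure R2 (D n)) \<longlonglongrightarrow> measure R2 (\<Inter>n. D n)"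
    using a2 by (intro R2.finite_Lim_measure_decseq D) (auto simp: D_def)
  ultimately have "eventually (\<lambda>n. measure R1 (D n) < e/2 \<and> measure R2 (D n) < e/2) sequentially"
    using \<open>0 < e\<close> D by (intro eventually_conj order_tendstoD(2)) auto
  then obtain n where n: "measure R1 (D n) < e/2" "measure R2 (D n) < e/2"
    by (auto simp: eventually_sequentially)
  \<comment> \<open>The \<open>n\<close> individual errors may use up the other half of
    \<open>e\<close>; the \<open>+ 1\<close> keeps the quotient defined for
    \<open>n = 0\<close>.\<close>
  define d where "d = e / (2 * (real n + 1))"
  have d: "0 < d" "real n * d < e / 2" using \<open>0 < e\<close> by (auto simp: d_def field_simps)
  from Union.IH[OF d(1)] obtain A where A: "\<And>i. A i \<in> \<A>"
    "\<And>i. measure R1 (sym_diff (a i) (A i)) < d" "\<And>i. measure R2 (sym_diff (a i) (A i)) < d"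
    by metis
  let ?B = "\<Union>i<n. A i"
  have sub: "sym_diff (\<Union>i. a i) ?B \<subseteq> D n \<union> (\<Union>i<n. sym_diff (a i) (A i))"
    by (auto simp: D_def)
  have bound: "measure R (sym_diff (\<Union>i. a i) ?B) < e"
    if R: "finite_measure R" "sets R = sigma_sets \<Omega> \<A>" "measure R (D n) < e/2"
      "\<And>i. measure R (sym_diff (a i) (A i)) < d" for R
  proof -
    interpret R: finite_measure R by fact
    have [measurable]: "a i \<in> sets R" "A i \<in> sets R" for i
      using Union.hyps A(1) by (auto simp: R(2))
    have [measurable]: "D n \<in> sets R" by (simp add: D_def)
    have "measure R (sym_diff (\<Union>i. a i) ?B) \<le> measure R (D n \<union> (\<Union>i<n. sym_diff (a i) (A i)))"
      by (intro R.finite_measure_mono sub) auto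
    also have "\<dots> \<le> measure R (D n) + measure R (\<Union>i<n. sym_diff (a i) (A i))"
      by (intro measure_Un_le) auto
    also have "measure R (\<Union>i<n. sym_diff (a i) (A i)) \<le> (\<Sum>i<n. measure R (sym_diff (a i) (A i)))"
      by (intro measure_UNION_le) auto
    also have "\<dots> \<le> (\<Sum>i<n. d)" by (intro sum_mono less_imp_le R(4))
    finally show ?thesis using R(3) d by simp
  qed
  show ?case
    using A n by (intro bexI[of _ ?B] conjI bound R1 R2 sets1 sets2) auto
qed

text \<open>Unions of rectangles over a countable partition of the second factor; the partition is encoded
  by a labelling \<open>\<phi>\<close>, so that two partitions are refined by pairing their labels.\<close>

definition fibered_set :: "'b measure \<Rightarrow> 'c measure \<Rightarrow> ('c \<Rightarrow> nat) \<Rightarrow> (nat \<Rightarrow> 'b set) \<Rightarrow> ('b \<times> 'c) set" where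
  "fibered_set P Q \<phi> F = {p \<in> space (P \<Otimes>\<^sub>M Q). fst p \<in> F (\<phi> (snd p))}"

definition fibered_sets :: "'b measure \<Rightarrow> 'c measure \<Rightarrow> ('b \<times> 'c) set set" where
  "fibered_sets P Q =
     {fibered_set P Q \<phi> F | \<phi> F. \<phi> \<in> Q \<rightarrow>\<^sub>M count_space UNIV \<and> range F \<subseteq> sets P}"

lemma fibered_set_UN:
  assumes "range F \<subseteq> sets P"
  shows "fibered_set P Q \<phi> F = (\<Union>i. F i \<times> (\<phi> -` {i} \<inter> space Q))"
  using assms sets.sets_into_space[of _ P] by (auto simp: fibered_set_def space_pair_measure)

text \<open>Every point of the second factor has exactly one label, so a complement is formed fibre
  by fibre with the labelling unchanged. A union is formed fibre by fibre once both sets share the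
  paired labelling.\<close>

lemma algebra_fibered_sets: "algebra (space (P \<Otimes>\<^sub>M Q)) (fibered_sets P Q)"
  unfolding algebra_iff_Un
proof (intro conjI ballI)
  let ?\<Omega> = "space (P \<Otimes>\<^sub>M Q)"
  show "fibered_sets P Q \<subseteq> Pow ?\<Omega>" by (auto simp: fibered_sets_def fibered_set_def)
  have "{} = fibered_set P Q (\<lambda>_. 0) (\<lambda>_. {})" by (simp add: fibered_set_def)
  then show "{} \<in> fibered_sets P Q" unfolding fibered_sets_def by force
  fix A assume "A \<in> fibered_sets P Q"
  then obtain \<phi> F where A: "A = fibered_set P Q \<phi> F"
    and [measurable]: "\<phi> \<in> Q \<rightarrow>\<^sub>M count_space UNIV" and F: "range F \<subseteq> sets P"
    by (auto simp: fibered_sets_def)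
  have "?\<Omega> - A = fibered_set P Q \<phi> (\<lambda>i. space P - F i)"
    by (auto simp: A fibered_set_def space_pair_measure)
  moreover have "range (\<lambda>i. space P - F i) \<subseteq> sets P" using F by auto
  ultimately show "?\<Omega> - A \<in> fibered_sets P Q"
    unfolding fibered_sets_def by (auto intro!: exI[of _ \<phi>] exI[of _ "\<lambda>i. space P - F i"])
  fix B assume "B \<in> fibered_sets P Q"
  then obtain \<psi> G where B: "B = fibered_set P Q \<psi> G"
    and [measurable]: "\<psi> \<in> Q \<rightarrow>\<^sub>M count_space UNIV" and G: "range G \<subseteq> sets P"
    by (auto simp: fibered_sets_def)
  let ?\<chi> = "\<lambda>y. prod_encode (\<phi> y, \<psi> y)"
  let ?H = "\<lambda>i. F (fst (prod_decode i)) \<union> G (snd (prod_decode i))"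
  have "A \<union> B = fibered_set P Q ?\<chi> ?H" by (auto simp: A B fibered_set_def)
  moreover have "?\<chi> \<in> Q \<rightarrow>\<^sub>M count_space UNIV" by measurable
  moreover have "range ?H \<subseteq> sets P" using F G by auto
  ultimately show "A \<union> B \<in> fibered_sets P Q"
    unfolding fibered_sets_def by (auto intro!: exI[of _ ?\<chi>] exI[of _ ?H])
qed

lemma sets_pair_eq_sigma_fibered_sets:
  "sets (P \<Otimes>\<^sub>M Q) = sigma_sets (space (P \<Otimes>\<^sub>M Q)) (fibered_sets P Q)"
proof (rule antisym)
  have "{a \<times> b |a b. a \<in> sets P \<and> b \<in> sets Q} \<subseteq> fibered_sets P Q"
  proof safe
    fix a b assume ab[measurable]: "a \<in> sets P" "b \<in> sets Q"
    \<comment> \<open>Two labels suffice for a rectangle: points of \<open>b\<close> get the fibre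
      \<open>a\<close>, all others the empty fibre.\<close>
    let ?\<phi> = "\<lambda>y. if y \<in> b then 1 else 0 :: nat" and ?F = "\<lambda>i::nat. if i = 1 then a else {}"
    have "a \<times> b = fibered_set P Q ?\<phi> ?F"
      using ab[THEN sets.sets_into_space] by (auto simp: fibered_set_def space_pair_measure split: if_splits)
    moreover have "?\<phi> \<in> Q \<rightarrow>\<^sub>M count_space UNIV" by measurable
    ultimately show "a \<times> b \<in> fibered_sets P Q"
      unfolding fibered_sets_def by (auto intro!: exI[of _ ?\<phi>] exI[of _ ?F])
  qed
  then show "sets (P \<Otimes>\<^sub>M Q) \<subseteq> sigma_sets (space (P \<Otimes>\<^sub>M Q)) (fibered_sets P Q)"
    unfolding sets_pair_measure space_pair_measure by (rule sigma_sets_subseteq)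
  have "A \<in> sets (P \<Otimes>\<^sub>M Q)" if A: "A \<in> fibered_sets P Q" for A
  proof -
    from A obtain \<phi> F where A: "A = fibered_set P Q \<phi> F"
      and [measurable]: "\<phi> \<in> Q \<rightarrow>\<^sub>M count_space UNIV" and F: "range F \<subseteq> sets P"
      by (auto simp: fibered_sets_def)
    then show ?thesis using F unfolding A fibered_set_UN[OF F]
      by (intro sets.countable_UN) auto
  qed
  then show "sigma_sets (space (P \<Otimes>\<^sub>M Q)) (fibered_sets P Q) \<subseteq> sets (P \<Otimes>\<^sub>M Q)"
    by (intro sets.sigma_sets_subset) auto
qed

section \<open>Decoupling a pair of random variables at the cost of one mixing coefficient\<close>

context prob_space
begin

text \<open>As \<open>ess_Sup\<close> is a choice, its defining properties become available only
  after the family is bounded: probabilities and conditional probabilities lie in the unit interval,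
  so the constant 1 dominates almost surely. The exceptional null set may depend on
  \<open>E\<close>, hence the statement for each event separately.\<close>

lemma AE_cond_prob_le_ess_Sup:
  assumes E1: "subalgebra M \<E>\<^sub>1" and E2: "subalgebra M \<E>\<^sub>2"
  defines "W \<equiv> ess_Sup M ((\<lambda>E \<omega>. ennreal \<bar>prob E - real_cond_exp M \<E>\<^sub>2 (indicator E) \<omega>\<bar>) ` sets \<E>\<^sub>1)"
  shows "W \<in> borel_measurable M"
    and "E \<in> sets \<E>\<^sub>1 \<Longrightarrow> AE \<omega> in M. ennreal (real_cond_exp M \<E>\<^sub>2 (indicator E) \<omega>) \<le> emeasure M E + W \<omega>"
proof -
  interpret finite_measure_subalgebra M \<E>\<^sub>2 by unfold_locales fact
  let ?\<X> = "(\<lambda>E \<omega>. ennreal \<bar>prob E - real_cond_exp M \<E>\<^sub>2 (indicator E) \<omega>\<bar>) ` sets \<E>\<^sub>1"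
  have sub: "E \<in> sets M" if "E \<in> sets \<E>\<^sub>1" for E using E1 that by (auto simp: subalgebra_def)
  have bnd: "AE \<omega> in M. ennreal \<bar>prob E - real_cond_exp M \<E>\<^sub>2 (indicator E) \<omega>\<bar> \<le> ennreal 1"
    if "E \<in> sets \<E>\<^sub>1" for E
  proof -
    have [measurable]: "E \<in> sets M" using sub that by auto
    have "AE \<omega> in M. real_cond_exp M \<E>\<^sub>2 (indicator E) \<omega> \<ge> 0"
      by (intro real_cond_exp_pos) auto
    moreover have "AE \<omega> in M. real_cond_exp M \<E>\<^sub>2 (indicator E) \<omega> \<le> 1"
      by (intro real_cond_exp_le_c integrable_real_indicator) (auto simp: indicator_def emeasure_eq_measure)
    ultimately show ?thesis
    proof eventually_elim
      case (elim \<omega>)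
      then show ?case using prob_le_1[of E] measure_nonneg[of M E]
        by (intro ennreal_leI) linarith
    qed
  qed
  have W: "is_ess_Sup M ?\<X> W"
    unfolding W_def
    by (rule is_ess_Sup_ess_Sup[where c=1]) (use bnd finite_measure_axioms in auto)
  show "W \<in> borel_measurable M" using W by (simp add: is_ess_Sup_def)
  assume E: "E \<in> sets \<E>\<^sub>1"
  then have "AE \<omega> in M. ennreal \<bar>prob E - real_cond_exp M \<E>\<^sub>2 (indicator E) \<omega>\<bar> \<le> W \<omega>"
    using W by (auto simp: is_ess_Sup_def)
  then show "AE \<omega> in M. ennreal (real_cond_exp M \<E>\<^sub>2 (indicator E) \<omega>) \<le> emeasure M E + W \<omega>"
  proof eventually_elim
    case (elim \<omega>)
    let ?r = "real_cond_exp M \<E>\<^sub>2 (indicator E) \<omega>"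
    have "ennreal ?r \<le> ennreal (prob E + \<bar>prob E - ?r\<bar>)" by (intro ennreal_leI) auto
    also have "\<dots> = emeasure M E + ennreal \<bar>prob E - ?r\<bar>"
      by (simp add: ennreal_plus emeasure_eq_measure)
    also have "\<dots> \<le> emeasure M E + W \<omega>" using elim by (intro add_left_mono)
    finally show ?case .
  qed
qed

text \<open>The probability of the intersection is the integral over \<open>F\<close> of the
  conditional probability of \<open>E\<close>. The error term is kept as an integral over
  \<open>F\<close>, not bounded by the integral over the whole space, so that the errors for
  disjoint \<open>F\<close> add up to at most one mixing coefficient.\<close>

lemma emeasure_Int_le_ess_Sup:
  assumes E1: "subalgebra M \<E>\<^sub>1" and E2: "subalgebra M \<E>\<^sub>2"
    and E: "E \<in> sets \<E>\<^sub>1" and F: "F \<in> sets \<E>\<^sub>2"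
  defines "W \<equiv> ess_Sup M ((\<lambda>E \<omega>. ennreal \<bar>prob E - real_cond_exp M \<E>\<^sub>2 (indicator E) \<omega>\<bar>) ` sets \<E>\<^sub>1)"
  shows "emeasure M (E \<inter> F) \<le> emeasure M E * emeasure M F + (\<integral>\<^sup>+\<omega>\<in>F. W \<omega> \<partial>M)"
proof -
  interpret finite_measure_subalgebra M \<E>\<^sub>2 by unfold_locales fact
  have [measurable]: "E \<in> sets M" "F \<in> sets M" using E F E1 E2 by (auto simp: subalgebra_def)
  note W = AE_cond_prob_le_ess_Sup[OF E1 E2, folded W_def]
  have [measurable]: "W \<in> borel_measurable M" by (rule W(1))
  let ?r = "real_cond_exp M \<E>\<^sub>2 (indicator E)"
  have r_meas[measurable]: "?r \<in> borel_measurable M" by simp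
  have pos: "AE \<omega> in M. ?r \<omega> \<ge> 0" by (intro real_cond_exp_pos) auto
  have int: "integrable M (indicator E :: _ \<Rightarrow> real)"
    by (intro integrable_real_indicator) (auto simp: emeasure_eq_measure)
  have "emeasure M (E \<inter> F) = ennreal (\<integral>\<omega>. indicator F \<omega> * indicator E \<omega> \<partial>M)"
    by (simp add: emeasure_eq_measure indicator_inter_arith[symmetric] Int_commute)
  also have "(\<integral>\<omega>. indicator F \<omega> * indicator E \<omega> \<partial>M) = (\<integral>\<omega>. indicator F \<omega> * ?r \<omega> \<partial>M)"
    using real_cond_exp_intA[OF int F] by (simp add: set_lebesgue_integral_def)
  also have "ennreal \<dots> = (\<integral>\<^sup>+\<omega>. ennreal (indicator F \<omega> * ?r \<omega>) \<partial>M)"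
  proof (rule nn_integral_eq_integral[symmetric])
    show "integrable M (\<lambda>\<omega>. indicator F \<omega> * ?r \<omega>)"
      using integrable_mult_indicator[OF \<open>F \<in> sets M\<close> real_cond_exp_int(1)[OF int]] by simp
    show "AE \<omega> in M. 0 \<le> indicator F \<omega> * ?r \<omega>" using pos by eventually_elim auto
  qed
  also have "\<dots> \<le> (\<integral>\<^sup>+\<omega>. emeasure M E * indicator F \<omega> + W \<omega> * indicator F \<omega> \<partial>M)"
  proof (rule nn_integral_mono_AE)
    show "AE \<omega> in M. ennreal (indicator F \<omega> * ?r \<omega>) \<le> emeasure M E * indicator F \<omega> + W \<omega> * indicator F \<omega>"
      using W(2)[OF E] by eventually_elim (auto simp: indicator_def)
  qed
  also have "\<dots> = emeasure M E * emeasure M F + (\<integral>\<^sup>+\<omega>\<in>F. W \<omega> \<partial>M)"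
    by (subst nn_integral_add) (auto simp: nn_integral_cmult_indicator)
  finally show ?thesis .
qed

lemma joint_law_le_product_plus_beta:
  assumes E1: "subalgebra M \<E>\<^sub>1" and E2: "subalgebra M \<E>\<^sub>2"
    and X: "X \<in> \<E>\<^sub>1 \<rightarrow>\<^sub>M P" and Y: "Y \<in> \<E>\<^sub>2 \<rightarrow>\<^sub>M Q"
    and C: "C \<in> sets (P \<Otimes>\<^sub>M Q)"
  shows "emeasure (distr M (P \<Otimes>\<^sub>M Q) (\<lambda>\<omega>. (X \<omega>, Y \<omega>))) C
    \<le> emeasure (distr M P X \<Otimes>\<^sub>M distr M Q Y) C + beta_coeff M \<E>\<^sub>1 \<E>\<^sub>2"
proof -
  define W where "W = ess_Sup M ((\<lambda>E \<omega>. ennreal \<bar>prob E - real_cond_exp M \<E>\<^sub>2 (indicator E) \<omega>\<bar>) ` sets \<E>\<^sub>1)"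
  have beta: "beta_coeff M \<E>\<^sub>1 \<E>\<^sub>2 = (\<integral>\<^sup>+\<omega>. W \<omega> \<partial>M)" by (simp add: beta_coeff_def W_def)
  have [measurable]: "W \<in> borel_measurable M"
    unfolding W_def by (rule AE_cond_prob_le_ess_Sup(1)[OF E1 E2])
  have [measurable]: "X \<in> M \<rightarrow>\<^sub>M P" "Y \<in> M \<rightarrow>\<^sub>M Q"
    using X Y E1 E2 by (auto intro: measurable_from_subalg)
  have space: "space \<E>\<^sub>1 = space M" "space \<E>\<^sub>2 = space M" using E1 E2 by (auto simp: subalgebra_def)
  let ?R1 = "distr M (P \<Otimes>\<^sub>M Q) (\<lambda>\<omega>. (X \<omega>, Y \<omega>))" and ?R2 = "distr M P X \<Otimes>\<^sub>M distr M Q Y"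
  interpret PX: prob_space "distr M P X" by (rule prob_space_distr) simp
  interpret QY: prob_space "distr M Q Y" by (rule prob_space_distr) simp
  interpret R1: prob_space ?R1 by (rule prob_space_distr) simp
  interpret R2: prob_space ?R2 by (rule prob_space_pair) unfold_locales
  have sets2: "sets ?R2 = sets (P \<Otimes>\<^sub>M Q)" by (intro sets_pair_measure_cong) auto
  have main: "emeasure ?R1 A \<le> emeasure ?R2 A + beta_coeff M \<E>\<^sub>1 \<E>\<^sub>2" if A: "A \<in> fibered_sets P Q" for A
  proof -
    from A obtain \<phi> F where A: "A = fibered_set P Q \<phi> F"
      and \<phi>[measurable]: "\<phi> \<in> Q \<rightarrow>\<^sub>M count_space UNIV" and F: "range F \<subseteq> sets P"
      by (auto simp: fibered_sets_def)
    define B where "B i = \<phi> -` {i} \<inter> space Q" for i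
    have Fm[measurable]: "F i \<in> sets P" for i using F by auto
    have Bm[measurable]: "B i \<in> sets Q" for i unfolding B_def by measurable
    have disj: "disjoint_family (\<lambda>i. F i \<times> B i)" by (auto simp: disjoint_family_on_def B_def)
    have A_UN: "A = (\<Union>i. F i \<times> B i)" unfolding A B_def by (rule fibered_set_UN[OF F])
    \<comment> \<open>\<open>W\<close> is the same for all \<open>i\<close>, although the event for
      the first variable changes with \<open>i\<close>. This is where an essential supremum inside
      the expectation is required.\<close>
    have R1_rect: "emeasure ?R1 (F i \<times> B i) \<le> emeasure ?R2 (F i \<times> B i) + (\<integral>\<^sup>+\<omega>\<in>Y -` B i \<inter> space M. W \<omega> \<partial>M)" for i
    proof -
      have "emeasure ?R1 (F i \<times> B i) = emeasure M ((X -` F i \<inter> space M) \<inter> (Y -` B i \<inter> space M))"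
        by (subst emeasure_distr) (auto intro!: arg_cong[where f="emeasure M"])
      also have "\<dots> \<le> emeasure M (X -` F i \<inter> space M) * emeasure M (Y -` B i \<inter> space M)
          + (\<integral>\<^sup>+\<omega>\<in>Y -` B i \<inter> space M. W \<omega> \<partial>M)"
        unfolding W_def
        using measurable_sets[OF X Fm[of i]] measurable_sets[OF Y Bm[of i]] space
        by (intro emeasure_Int_le_ess_Sup[OF E1 E2]) auto
      also have "emeasure M (X -` F i \<inter> space M) * emeasure M (Y -` B i \<inter> space M) = emeasure ?R2 (F i \<times> B i)"
        by (subst QY.emeasure_pair_measure_Times) (auto simp: emeasure_distr)
      finally show ?thesis .
    qed
    have "emeasure ?R1 A = (\<Sum>i. emeasure ?R1 (F i \<times> B i))"
      unfolding A_UN by (intro suminf_emeasure[symmetric] disj) auto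
    also have "\<dots> \<le> (\<Sum>i. emeasure ?R2 (F i \<times> B i) + (\<integral>\<^sup>+\<omega>\<in>Y -` B i \<inter> space M. W \<omega> \<partial>M))"
      by (intro suminf_le R1_rect) auto
    also have "\<dots> = (\<Sum>i. emeasure ?R2 (F i \<times> B i)) + (\<Sum>i. \<integral>\<^sup>+\<omega>\<in>Y -` B i \<inter> space M. W \<omega> \<partial>M)"
      by (intro suminf_add[symmetric]) auto
    also have "(\<Sum>i. emeasure ?R2 (F i \<times> B i)) = emeasure ?R2 A"
      unfolding A_UN by (intro suminf_emeasure disj) auto
    also have "(\<Sum>i. \<integral>\<^sup>+\<omega>\<in>Y -` B i \<inter> space M. W \<omega> \<partial>M) = (\<integral>\<^sup>+\<omega>. (\<Sum>i. W \<omega> * indicator (Y -` B i \<inter> space M) \<omega>) \<partial>M)"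
      by (intro nn_integral_suminf[symmetric]) measurable
    \<comment> \<open>The preimages of the cells \<open>B i\<close> partition the space: only the
      summand whose index is the label of \<open>Y \<omega>\<close> survives.\<close>
    also have "\<dots> = (\<integral>\<^sup>+\<omega>. W \<omega> \<partial>M)"
    proof (rule nn_integral_cong)
      fix \<omega> assume \<omega>: "\<omega> \<in> space M"
      then have "Y \<omega> \<in> space Q" by (rule measurable_space[OF \<open>Y \<in> M \<rightarrow>\<^sub>M Q\<close>])
      then have "\<And>i. i \<noteq> \<phi> (Y \<omega>) \<Longrightarrow> W \<omega> * indicator (Y -` B i \<inter> space M) \<omega> = 0"
        and "W \<omega> * indicator (Y -` B (\<phi> (Y \<omega>)) \<inter> space M) \<omega> = W \<omega>"
        using \<omega> by (auto simp: B_def)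
      then show "(\<Sum>i. W \<omega> * indicator (Y -` B i \<inter> space M) \<omega>) = W \<omega>"
        by (subst suminf_finite[of "{\<phi> (Y \<omega>)}"]) auto
    qed
    finally show ?thesis by (simp add: beta)
  qed
  show ?thesis
  \<comment> \<open>\<open>C\<close> is exchanged for \<open>A\<close> under the joint law and
    \<open>A\<close> for \<open>C\<close> under the product law; each exchange costs
    \<open>e/2\<close>.\<close>
  proof (rule ennreal_le_epsilon)
    fix e :: real assume e: "0 < e"
    have "\<exists>A\<in>fibered_sets P Q. measure ?R1 (sym_diff C A) < e/2 \<and> measure ?R2 (sym_diff C A) < e/2"
    proof (rule approx_algebra_two_measures[OF _ _ _ _ algebra_fibered_sets])
      show "finite_measure ?R1" by (rule R1.finite_measure_axioms)
      show "finite_measure ?R2" by (rule R2.finite_measure_axioms)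
      show "C \<in> sigma_sets (space (P \<Otimes>\<^sub>M Q)) (fibered_sets P Q)"
        using C by (simp add: sets_pair_eq_sigma_fibered_sets)
      show "sets ?R1 = sigma_sets (space (P \<Otimes>\<^sub>M Q)) (fibered_sets P Q)"
        by (simp add: sets_pair_eq_sigma_fibered_sets)
      show "sets ?R2 = sigma_sets (space (P \<Otimes>\<^sub>M Q)) (fibered_sets P Q)"
        by (rule trans[OF sets2 sets_pair_eq_sigma_fibered_sets])
    qed (use e in simp)
    then obtain A where A: "A \<in> fibered_sets P Q"
      and eA: "measure ?R1 (sym_diff C A) < e/2" "measure ?R2 (sym_diff C A) < e/2" by blast
    have Am: "A \<in> sets (P \<Otimes>\<^sub>M Q)" using A unfolding sets_pair_eq_sigma_fibered_sets by auto
    have "emeasure ?R1 C \<le> emeasure ?R1 (A \<union> sym_diff C A)"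
      using C Am by (intro emeasure_mono) auto
    also have "\<dots> \<le> emeasure ?R1 A + emeasure ?R1 (sym_diff C A)"
      using C Am by (intro emeasure_subadditive) auto
    also have "emeasure ?R1 (sym_diff C A) \<le> ennreal (e/2)"
      using eA by (simp add: R1.emeasure_eq_measure ennreal_leI)
    also have "emeasure ?R1 A \<le> emeasure ?R2 A + beta_coeff M \<E>\<^sub>1 \<E>\<^sub>2" by (rule main[OF A])
    also have "emeasure ?R2 A \<le> emeasure ?R2 (C \<union> sym_diff C A)"
      using C Am by (intro emeasure_mono) (auto simp: sets2)
    also have "\<dots> \<le> emeasure ?R2 C + emeasure ?R2 (sym_diff C A)"
      using C Am by (intro emeasure_subadditive) (auto simp: sets2)
    also have "emeasure ?R2 (sym_diff C A) \<le> ennreal (e/2)"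
      using eA by (simp add: R2.emeasure_eq_measure ennreal_leI)
    also have "emeasure ?R2 C + ennreal (e/2) + beta_coeff M \<E>\<^sub>1 \<E>\<^sub>2 + ennreal (e/2)
        = emeasure ?R2 C + beta_coeff M \<E>\<^sub>1 \<E>\<^sub>2 + (ennreal (e/2) + ennreal (e/2))"
      by (simp add: ac_simps)
    also have "ennreal (e/2) + ennreal (e/2) = ennreal e"
      using e by (subst ennreal_plus[symmetric]) auto
    finally show "emeasure ?R1 C \<le> emeasure ?R2 C + beta_coeff M \<E>\<^sub>1 \<E>\<^sub>2 + ennreal e"
      by (simp add: add_mono)
  qed
qed

end

section \<open>The law of a block compared with the product of its marginals\<close>

lemma measurable_sigma_seq:
  assumes "\<And>k. k \<in> I \<Longrightarrow> Z k \<in> M \<rightarrow>\<^sub>M borel_of (S k)"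
  shows "subalgebra M (sigma_seq M S Z I)"
    and "(\<lambda>\<omega>. \<lambda>i\<in>I. Z i \<omega>) \<in> sigma_seq M S Z I \<rightarrow>\<^sub>M (\<Pi>\<^sub>M i\<in>I. borel_of (S i))"
proof -
  have *: "(\<lambda>\<omega>. \<lambda>i\<in>I. Z i \<omega>) \<in> M \<rightarrow>\<^sub>M (\<Pi>\<^sub>M i\<in>I. borel_of (S i))"
    using assms by (rule measurable_restrict)
  then have sp: "(\<lambda>\<omega>. \<lambda>i\<in>I. Z i \<omega>) \<in> space M \<rightarrow> space (\<Pi>\<^sub>M i\<in>I. borel_of (S i))"
    by (auto dest: measurable_space)
  show "subalgebra M (sigma_seq M S Z I)"
    using measurable_sets[OF *]
    by (auto simp: subalgebra_def sigma_seq_def sets_vimage_algebra2[OF sp])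
  show "(\<lambda>\<omega>. \<lambda>i\<in>I. Z i \<omega>) \<in> sigma_seq M S Z I \<rightarrow>\<^sub>M (\<Pi>\<^sub>M i\<in>I. borel_of (S i))"
    unfolding sigma_seq_def by (rule measurable_vimage_algebra1[OF sp])
qed

text \<open>Puts the separated coordinate back after the pair bound has been applied. Both measures
  integrate indicators in the same iterated way, by Fubini.\<close>

lemma (in product_sigma_finite) distr_fun_upd_PiM:
  assumes "finite I" "i \<notin> I"
  shows "distr (Pi\<^sub>M I M \<Otimes>\<^sub>M M i) (Pi\<^sub>M (insert i I) M) (\<lambda>(f, y). f(i := y)) = Pi\<^sub>M (insert i I) M"
proof (rule measure_eqI)
  fix A assume "A \<in> sets (distr (Pi\<^sub>M I M \<Otimes>\<^sub>M M i) (Pi\<^sub>M (insert i I) M) (\<lambda>(f, y). f(i := y)))"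
  then have [measurable]: "A \<in> sets (Pi\<^sub>M (insert i I) M)" by simp
  interpret I: finite_product_sigma_finite M I by unfold_locales fact
  interpret pair_sigma_finite "Pi\<^sub>M I M" "M i" ..
  let ?D = "distr (Pi\<^sub>M I M \<Otimes>\<^sub>M M i) (Pi\<^sub>M (insert i I) M) (\<lambda>(f, y). f(i := y))"
  have m[measurable]: "(\<lambda>(f, y). f(i := y)) \<in> Pi\<^sub>M I M \<Otimes>\<^sub>M M i \<rightarrow>\<^sub>M Pi\<^sub>M (insert i I) M"
    by (rule measurable_add_dim)
  have "emeasure ?D A = (\<integral>\<^sup>+f. indicator A f \<partial>?D)" by simp
  also have "\<dots> = (\<integral>\<^sup>+p. indicator A ((\<lambda>(f, y). f(i := y)) p) \<partial>(Pi\<^sub>M I M \<Otimes>\<^sub>M M i))"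
    by (intro nn_integral_distr) measurable
  also have "\<dots> = (\<integral>\<^sup>+y. (\<integral>\<^sup>+f. indicator A (f(i := y)) \<partial>Pi\<^sub>M I M) \<partial>M i)"
    by (subst nn_integral_snd[symmetric]) (auto intro!: measurable_compose[OF m])
  also have "\<dots> = (\<integral>\<^sup>+f. indicator A f \<partial>Pi\<^sub>M (insert i I) M)"
    by (intro product_nn_integral_insert_rev[symmetric] assms) simp
  finally show "emeasure ?D A = emeasure (Pi\<^sub>M (insert i I) M) A" by simp
qed simp

text \<open>The assumed inequality is applied to every section and integrated. Since
  \<open>Q\<close> has total mass 1, the constant \<open>c\<close> is not enlarged.\<close>

lemma emeasure_pair_le_add:
  assumes "prob_space P" "prob_space P'" "prob_space Q" and sets: "sets P = sets P'"
    and le: "\<And>A. A \<in> sets P \<Longrightarrow> emeasure P A \<le> emeasure P' A + c"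
    and C: "C \<in> sets (P \<Otimes>\<^sub>M Q)"
  shows "emeasure (P \<Otimes>\<^sub>M Q) C \<le> emeasure (P' \<Otimes>\<^sub>M Q) C + c"
proof -
  interpret P: prob_space P by fact
  interpret P': prob_space P' by fact
  interpret Q: prob_space Q by fact
  interpret PQ: pair_sigma_finite P Q ..
  interpret P'Q: pair_sigma_finite P' Q ..
  have C': "C \<in> sets (P' \<Otimes>\<^sub>M Q)" using C sets_pair_measure_cong[OF sets refl[of "sets Q"]] by simp
  have "emeasure (P \<Otimes>\<^sub>M Q) C = (\<integral>\<^sup>+y. emeasure P ((\<lambda>x. (x, y)) -` C) \<partial>Q)"
    by (rule PQ.emeasure_pair_measure_alt2[OF C])
  also have "\<dots> \<le> (\<integral>\<^sup>+y. emeasure P' ((\<lambda>x. (x, y)) -` C) + c \<partial>Q)"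
    by (intro nn_integral_mono le sets_Pair2[OF C])
  also have "\<dots> = (\<integral>\<^sup>+y. emeasure P' ((\<lambda>x. (x, y)) -` C) \<partial>Q) + c"
    using P'Q.measurable_emeasure_Pair2[OF C'] by (subst nn_integral_add) (auto simp: Q.emeasure_space_1)
  also have "(\<integral>\<^sup>+y. emeasure P' ((\<lambda>x. (x, y)) -` C) \<partial>Q) = emeasure (P' \<Otimes>\<^sub>M Q) C"
    by (rule P'Q.emeasure_pair_measure_alt2[OF C', symmetric])
  finally show ?thesis .
qed

text \<open>Induction on the largest index: the last variable is separated from its entire past
  within the block, which is the situation measured by its coefficient. The past is then treated by
  the induction hypothesis.\<close>

lemma (in prob_space) law_le_product_plus_beta_seq:
  assumes J: "finite J" "0 \<notin> J"
    and meas: "\<And>k. k \<in> J \<Longrightarrow> Z k \<in> M \<rightarrow>\<^sub>M borel_of (S k)"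
    and L: "product_prob_space L" "\<And>k. k \<in> J \<Longrightarrow> L k = distr M (borel_of (S k)) (Z k)"
    and C: "C \<in> sets (\<Pi>\<^sub>M i\<in>J. borel_of (S i))"
  shows "emeasure (distr M (\<Pi>\<^sub>M i\<in>J. borel_of (S i)) (\<lambda>\<omega>. \<lambda>i\<in>J. Z i \<omega>)) C
    \<le> emeasure (Pi\<^sub>M J L) C + (\<Sum>k\<in>J. beta_seq M S Z J 1 k)"
  using J meas L(2) C
proof (induction J arbitrary: C rule: finite_linorder_max_induct)
  case empty
  interpret D: prob_space "distr M (Pi\<^sub>M {} (\<lambda>i. borel_of (S i))) (\<lambda>\<omega>. \<lambda>i\<in>{}. Z i \<omega>)"
    by (rule prob_space_distr) (auto intro: measurable_restrict)
  \<comment> \<open>The empty product is a one-point space, on which all probability measures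
    agree.\<close>
  have "C = {} \<or> C = {\<lambda>_. undefined}"
    using empty.prems by (auto simp: sets_PiM_empty)
  then show ?case
  proof
    assume C: "C = {\<lambda>_. undefined}"
    have "emeasure (distr M (Pi\<^sub>M {} (\<lambda>i. borel_of (S i))) (\<lambda>\<omega>. \<lambda>i\<in>{}. Z i \<omega>)) C \<le> 1"
      by (rule D.emeasure_le_1)
    also have "1 = emeasure (Pi\<^sub>M {} L) C" by (simp add: C)
    finally show ?thesis by (rule order_trans) simp
  qed simp
next
  case (insert b A)
  interpret L: product_prob_space L by fact
  let ?B = "\<lambda>I. \<Pi>\<^sub>M i\<in>I. borel_of (S i)"
  let ?X = "\<lambda>\<omega>. \<lambda>i\<in>A. Z i \<omega>"
  let ?E1 = "sigma_seq M S Z A" and ?E2 = "sigma_seq M S Z {b}"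
  let ?u = "\<lambda>(f, y). f(b := y)"
  have b: "b \<notin> A" "0 < b" using insert.hyps insert.prems by auto
  have [measurable]: "Z b \<in> M \<rightarrow>\<^sub>M borel_of (S b)" "?X \<in> M \<rightarrow>\<^sub>M ?B A"
    using insert.prems by (auto intro: measurable_restrict)
  have u[measurable]: "?u \<in> ?B A \<Otimes>\<^sub>M borel_of (S b) \<rightarrow>\<^sub>M ?B (insert b A)"
    by (rule measurable_add_dim)
  have sets_L: "sets (L k) = sets (borel_of (S k))" if "k \<in> insert b A" for k
    using insert.prems(3)[OF that] by simp
  have sets_PL: "sets (Pi\<^sub>M I L) = sets (?B I)" if "I \<subseteq> insert b A" for I
    using that by (intro sets_PiM_cong sets_L) auto
  have sets_pair: "sets (Pi\<^sub>M A L \<Otimes>\<^sub>M L b) = sets (?B A \<Otimes>\<^sub>M borel_of (S b))"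
    by (intro sets_pair_measure_cong sets_PL sets_L) auto
  define D where "D = ?u -` C \<inter> space (?B A \<Otimes>\<^sub>M borel_of (S b))"
  have D: "D \<in> sets (?B A \<Otimes>\<^sub>M borel_of (S b))"
    unfolding D_def using insert.prems by (intro measurable_sets[OF u]) auto
  have sub: "subalgebra M ?E1" "?X \<in> ?E1 \<rightarrow>\<^sub>M ?B A" "subalgebra M ?E2"
    using insert.prems by (auto intro!: measurable_sigma_seq)
  have Yb: "Z b \<in> ?E2 \<rightarrow>\<^sub>M borel_of (S b)"
    using measurable_compose[OF measurable_sigma_seq(2)[of "{b}" Z M S] measurable_component_singleton[of b]]
      insert.prems by simp
  \<comment> \<open>Here \<open>b\<close> exceeds all of \<open>A\<close> and 0 is excluded, so the
    indices from 1 to \<open>b - 1\<close> in the block are all of \<open>A\<close>.\<close>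
  have eq_b: "insert b A \<inter> {1..b - 1} = A" "insert b A \<inter> {b} = {b}"
    using insert.hyps insert.prems(1) by (fastforce simp: Suc_le_eq intro: gr0I)+
  have beta_b: "beta_seq M S Z (insert b A) 1 b = beta_coeff M ?E1 ?E2"
    unfolding beta_seq_def eq_b ..
  \<comment> \<open>Adding a later index changes neither the past nor the present of
    \<open>k\<close>, so the coefficients of the induction hypothesis carry over.\<close>
  have beta_A: "beta_seq M S Z (insert b A) 1 k = beta_seq M S Z A 1 k" if "k \<in> A" for k
  proof -
    have "insert b A \<inter> {1..k - 1} = A \<inter> {1..k - 1}" "insert b A \<inter> {k} = A \<inter> {k}"
      using insert.hyps that by auto
    then show ?thesis by (simp add: beta_seq_def)
  qed
  have IH: "emeasure (distr M (?B A) ?X) C' \<le> emeasure (Pi\<^sub>M A L) C' + (\<Sum>k\<in>A. beta_seq M S Z A 1 k)"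
    if "C' \<in> sets (?B A)" for C'
    using insert.prems that by (intro insert.IH) auto
  have "emeasure (distr M (?B (insert b A)) (\<lambda>\<omega>. \<lambda>i\<in>insert b A. Z i \<omega>)) C
      = emeasure M ((\<lambda>\<omega>. \<lambda>i\<in>insert b A. Z i \<omega>) -` C \<inter> space M)"
    using insert.prems by (intro emeasure_distr measurable_restrict) auto
  also have "(\<lambda>\<omega>. \<lambda>i\<in>insert b A. Z i \<omega>) -` C \<inter> space M = (\<lambda>\<omega>. (?X \<omega>, Z b \<omega>)) -` D \<inter> space M"
  proof -
    have "(\<lambda>i\<in>insert b A. Z i \<omega>) = (?X \<omega>)(b := Z b \<omega>)" for \<omega> by auto
    moreover have "(?X \<omega>, Z b \<omega>) \<in> space (?B A \<Otimes>\<^sub>M borel_of (S b))" if "\<omega> \<in> space M" for \<omega>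
      using that by (intro measurable_space[of "\<lambda>\<omega>. (?X \<omega>, Z b \<omega>)" M]) measurable
    ultimately show ?thesis by (auto simp: D_def)
  qed
  also have "emeasure M \<dots> = emeasure (distr M (?B A \<Otimes>\<^sub>M borel_of (S b)) (\<lambda>\<omega>. (?X \<omega>, Z b \<omega>))) D"
    using D by (intro emeasure_distr[symmetric]) auto
  also have "\<dots> \<le> emeasure (distr M (?B A) ?X \<Otimes>\<^sub>M distr M (borel_of (S b)) (Z b)) D + beta_coeff M ?E1 ?E2"
    by (rule joint_law_le_product_plus_beta[OF sub(1,3,2) Yb D])
  also have "emeasure (distr M (?B A) ?X \<Otimes>\<^sub>M distr M (borel_of (S b)) (Z b)) D
      \<le> emeasure (Pi\<^sub>M A L \<Otimes>\<^sub>M distr M (borel_of (S b)) (Z b)) D + (\<Sum>k\<in>A. beta_seq M S Z A 1 k)"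
  proof (rule emeasure_pair_le_add)
    show "prob_space (Pi\<^sub>M A L)" by (rule prob_space_PiM) unfold_locales
    have "sets (distr M (?B A) ?X \<Otimes>\<^sub>M distr M (borel_of (S b)) (Z b)) = sets (?B A \<Otimes>\<^sub>M borel_of (S b))"
      by (intro sets_pair_measure_cong) auto
    then show "D \<in> sets (distr M (?B A) ?X \<Otimes>\<^sub>M distr M (borel_of (S b)) (Z b))" using D by simp
  qed (use IH in \<open>auto intro!: prob_space_distr simp: sets_PL[OF subset_insertI]\<close>)
  also have "Pi\<^sub>M A L \<Otimes>\<^sub>M distr M (borel_of (S b)) (Z b) = Pi\<^sub>M A L \<Otimes>\<^sub>M L b"
    using insert.prems(3)[of b] by simp
  also have "emeasure (Pi\<^sub>M A L \<Otimes>\<^sub>M L b) D = emeasure (distr (Pi\<^sub>M A L \<Otimes>\<^sub>M L b) (Pi\<^sub>M (insert b A) L) ?u) C"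
    unfolding D_def sets_eq_imp_space_eq[OF sets_pair, symmetric]
    using insert.prems(4) by (intro emeasure_distr[symmetric] measurable_add_dim) (simp add: sets_PL)
  also have "distr (Pi\<^sub>M A L \<Otimes>\<^sub>M L b) (Pi\<^sub>M (insert b A) L) ?u = Pi\<^sub>M (insert b A) L"
    using insert.hyps b by (intro L.distr_fun_upd_PiM) auto
  also have "emeasure (Pi\<^sub>M (insert b A) L) C + (\<Sum>k\<in>A. beta_seq M S Z A 1 k) + beta_coeff M ?E1 ?E2
      = emeasure (Pi\<^sub>M (insert b A) L) C + (\<Sum>k\<in>insert b A. beta_seq M S Z (insert b A) 1 k)"
    using insert.hyps b by (simp add: beta_b beta_A ac_simps del: One_nat_def)
  finally show ?case by (simp add: add_mono)
qed

section \<open>Outer measures under unions, measurable maps and products\<close>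

lemma outer_measure_of_UN_le:
  assumes "finite I" and "\<And>i. i \<in> I \<Longrightarrow> A i \<subseteq> space M"
  shows "outer_measure_of M (\<Union>i\<in>I. A i) \<le> (\<Sum>i\<in>I. outer_measure_of M (A i))"
proof -
  obtain E where E: "\<And>i. i \<in> I \<Longrightarrow> E i \<in> sets M" "\<And>i. i \<in> I \<Longrightarrow> A i \<subseteq> E i"
    "\<And>i. i \<in> I \<Longrightarrow> outer_measure_of M (A i) = emeasure M (E i)"
    using outer_measure_of_attain[OF assms(2)] by metis
  have "outer_measure_of M (\<Union>i\<in>I. A i) \<le> outer_measure_of M (\<Union>i\<in>I. E i)"
    using E(2) by (intro outer_measure_of_mono) blast
  also have "\<dots> = emeasure M (\<Union>i\<in>I. E i)"
    using E(1) assms(1) by (intro outer_measure_of_eq sets.finite_UN) auto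
  also have "\<dots> \<le> (\<Sum>i\<in>I. emeasure M (E i))"
    using E(1) assms(1) by (intro emeasure_subadditive_finite) auto
  finally show ?thesis using E(3) by simp
qed

text \<open>A measurable cover of \<open>B\<close> pulls back to a measurable cover of its preimage.
  Only this inequality is general, because a cover of the preimage need not itself be a
  preimage.\<close>

lemma outer_measure_of_distr_ge:
  assumes f: "f \<in> M \<rightarrow>\<^sub>M N" and B: "B \<subseteq> space N"
  shows "outer_measure_of M (f -` B \<inter> space M) \<le> outer_measure_of (distr M N f) B"
proof -
  obtain E where E: "E \<in> sets N" "B \<subseteq> E" "outer_measure_of (distr M N f) B = emeasure (distr M N f) E"
    using outer_measure_of_attain[of B "distr M N f"] B by auto
  have "outer_measure_of M (f -` B \<inter> space M) \<le> outer_measure_of M (f -` E \<inter> space M)"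
    using E(2) by (intro outer_measure_of_mono) auto
  then show ?thesis using E f by (simp add: emeasure_distr measurable_sets)
qed

text \<open>A measurable set covering the cylinder has full sections over the base, so the base lies in
  the measurable set of points whose section has measure at least \<open>1\<close>.\<close>

lemma outer_measure_of_pair_fst:
  assumes "prob_space Q" and B: "B \<subseteq> space P"
  shows "outer_measure_of P B \<le> outer_measure_of (P \<Otimes>\<^sub>M Q) (B \<times> space Q)"
proof -
  interpret Q: prob_space Q by fact
  have "B \<times> space Q \<subseteq> space (P \<Otimes>\<^sub>M Q)" using B by (auto simp: space_pair_measure)
  from outer_measure_of_attain[OF this] obtain E where E[measurable]: "E \<in> sets (P \<Otimes>\<^sub>M Q)"
    and sub: "B \<times> space Q \<subseteq> E" and eq: "outer_measure_of (P \<Otimes>\<^sub>M Q) (B \<times> space Q) = emeasure (P \<Otimes>\<^sub>M Q) E"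
    by blast
  note [measurable] = Q.measurable_emeasure_Pair[OF E]
  define A where "A = {x \<in> space P. 1 \<le> emeasure Q (Pair x -` E)}"
  have A[measurable]: "A \<in> sets P" unfolding A_def by measurable
  have "B \<subseteq> A"
  proof
    fix x assume x: "x \<in> B"
    then have "space Q \<subseteq> Pair x -` E" using sub by auto
    then have "emeasure Q (space Q) \<le> emeasure Q (Pair x -` E)" by (intro emeasure_mono sets_Pair1[OF E])
    then show "x \<in> A" using x B by (auto simp: A_def Q.emeasure_space_1)
  qed
  then have "outer_measure_of P B \<le> emeasure P A"
    using outer_measure_of_mono[of B A P] by simp
  also have "\<dots> = (\<integral>\<^sup>+x. indicator A x \<partial>P)" by simp
  also have "\<dots> \<le> (\<integral>\<^sup>+x. emeasure Q (Pair x -` E) \<partial>P)"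
    by (intro nn_integral_mono) (auto simp: A_def indicator_def)
  also have "\<dots> = emeasure (P \<Otimes>\<^sub>M Q) E" by (rule Q.emeasure_pair_measure_alt[OF E, symmetric])
  finally show ?thesis by (simp add: eq)
qed

lemma outer_measure_of_pair_snd:
  assumes P: "prob_space P" and Q: "prob_space Q" and B: "B \<subseteq> space Q"
  shows "outer_measure_of Q B \<le> outer_measure_of (P \<Otimes>\<^sub>M Q) (space P \<times> B)"
proof -
  interpret pair_prob_space P Q using P Q by (simp add: pair_prob_space_def pair_sigma_finite_def prob_space_imp_sigma_finite)
  have "outer_measure_of Q B \<le> outer_measure_of (Q \<Otimes>\<^sub>M P) (B \<times> space P)"
    by (rule outer_measure_of_pair_fst[OF P B])
  also have "B \<times> space P = (\<lambda>(x, y). (y, x)) -` (space P \<times> B) \<inter> space (Q \<Otimes>\<^sub>M P)"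
    using B by (auto simp: space_pair_measure)
  also have "outer_measure_of (Q \<Otimes>\<^sub>M P) \<dots> \<le> outer_measure_of (distr (Q \<Otimes>\<^sub>M P) (P \<Otimes>\<^sub>M Q) (\<lambda>(x, y). (y, x))) (space P \<times> B)"
    using B by (intro outer_measure_of_distr_ge measurable_pair_swap') (auto simp: space_pair_measure)
  finally show ?thesis by (simp add: distr_pair_swap[symmetric])
qed

text \<open>A block is compared on the product over \<open>J\<close>, while the independent copy
  lives on the product over all indices; passing to the cylinder must not lower the outer
  probability. Splitting \<open>K\<close> into \<open>J\<close> and its complement turns the
  cylinder into a product set, and \<open>merge\<close> preserves the measure.\<close>

lemma (in product_prob_space) outer_measure_of_PiM_prod_emb:
  assumes "finite K" "J \<subseteq> K" and B: "B \<subseteq> space (Pi\<^sub>M J M)"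
  shows "outer_measure_of (Pi\<^sub>M J M) B \<le> outer_measure_of (Pi\<^sub>M K M) (prod_emb K M J B)"
proof -
  let ?P = "Pi\<^sub>M J M" and ?Q = "Pi\<^sub>M (K - J) M"
  have K: "J \<union> (K - J) = K" using assms by auto
  have Q: "prob_space ?Q" by (rule prob_space_PiM) unfold_locales
  have m: "merge J (K - J) \<in> ?P \<Otimes>\<^sub>M ?Q \<rightarrow>\<^sub>M Pi\<^sub>M K M"
    using measurable_merge[of J "K - J" M] unfolding K .
  have "outer_measure_of ?P B \<le> outer_measure_of (?P \<Otimes>\<^sub>M ?Q) (B \<times> space ?Q)"
    by (rule outer_measure_of_pair_fst[OF Q B])
  also have "\<dots> \<le> outer_measure_of (?P \<Otimes>\<^sub>M ?Q) (merge J (K - J) -` prod_emb K M J B \<inter> space (?P \<Otimes>\<^sub>M ?Q))"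
  proof (intro outer_measure_of_mono subsetI)
    fix p assume p: "p \<in> B \<times> space ?Q"
    then have sp: "p \<in> space (?P \<Otimes>\<^sub>M ?Q)" using B by (auto simp: space_pair_measure)
    have "restrict (merge J (K - J) p) J = fst p"
      using p B by (cases p) (auto simp: space_PiM PiE_def extensional_restrict)
    moreover have "merge J (K - J) p \<in> space (Pi\<^sub>M K M)" by (rule measurable_space[OF m sp])
    ultimately show "p \<in> merge J (K - J) -` prod_emb K M J B \<inter> space (?P \<Otimes>\<^sub>M ?Q)"
      using p sp by (auto simp: prod_emb_def space_PiM)
  qed
  also have "\<dots> \<le> outer_measure_of (distr (?P \<Otimes>\<^sub>M ?Q) (Pi\<^sub>M K M) (merge J (K - J))) (prod_emb K M J B)"
    by (intro outer_measure_of_distr_ge m) (auto simp: prod_emb_def space_PiM)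
  also have "distr (?P \<Otimes>\<^sub>M ?Q) (Pi\<^sub>M K M) (merge J (K - J)) = Pi\<^sub>M K M"
    using distr_merge[of J "K - J"] assms(1) finite_subset[OF assms(2,1)] unfolding K by auto
  finally show ?thesis .
qed

section \<open>Reduction of the supremum over all indices to the blocks\<close>

lemma sum_ereal_MInfty:
  fixes f :: "'b \<Rightarrow> ereal"
  assumes "finite A" "i \<in> A" "f i = - \<infinity>" "\<And>j. j \<in> A \<Longrightarrow> f j \<noteq> \<infinity>"
  shows "sum f A = - \<infinity>"
proof -
  have "sum f (A - {i}) \<noteq> \<infinity>" using assms by (auto simp: sum_Pinfty)
  then show ?thesis
    using sum.remove[OF assms(1,2), of f] assms(3) by (cases "sum f (A - {i})") auto
qed

text \<open>The average over all of \<open>I\<close> is a convex combination of the averages over the blocks of the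
  partition. Infinite integrals need care because \<^term>\<open>\<infinity> - \<infinity> = (\<infinity>::ereal)\<close> and \<open>b\<close> may be
  negative, so that multiplication by \<open>b\<close> need not distribute over the sum.\<close>

lemma average_le_if_block_averages_le:
  fixes b s :: real and e :: "nat \<Rightarrow> ereal" and x :: "nat \<Rightarrow> real"
  assumes I: "finite I" "I \<noteq> {}" and part: "partition_on I \<J>"
    and le: "\<And>J. J \<in> \<J> \<Longrightarrow>
      ereal (a * (sum x J / real (card J))) + ereal b * (sum e J / ereal (real (card J))) \<le> ereal s"
  shows "ereal (a * (sum x I / real (card I))) + ereal b * (sum e I / ereal (real (card I))) \<le> ereal s"
proof -
  have J: "finite J" "J \<noteq> {}" "0 < real (card J)" if "J \<in> \<J>" for J
  proof -
    show "finite J" "J \<noteq> {}"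
      using that part I by (auto simp: partition_on_def intro: finite_subset[of J I])
    then show "0 < real (card J)" by (simp add: card_gt_0_iff)
  qed
  have cI: "0 < real (card I)" using I by (simp add: card_gt_0_iff)
  have block: "\<exists>J\<in>\<J>. j \<in> J" if "j \<in> I" for j using that part by (auto simp: partition_on_def)
  have sub: "J \<subseteq> I" if "J \<in> \<J>" for J using that part by (auto simp: partition_on_def)
  have finJ: "finite \<J>" using I(1) part by (rule finite_elements)
  have disj: "\<And>J J'. J \<in> \<J> \<Longrightarrow> J' \<in> \<J> \<Longrightarrow> J \<noteq> J' \<Longrightarrow> J \<inter> J' = {}"
    using part by (auto simp: partition_on_def disjoint_def)
  have sumI: "sum f I = (\<Sum>J\<in>\<J>. sum f J)" for f :: "nat \<Rightarrow> real"
    using sum.Union_disjoint[of \<J> f] J disj part by (auto simp: partition_on_def)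
  consider "b = 0" | "b \<noteq> 0" "\<exists>j\<in>I. e j = \<infinity>"
    | "b \<noteq> 0" "\<forall>j\<in>I. e j \<noteq> \<infinity>" "\<exists>j\<in>I. e j = - \<infinity>"
    | "\<forall>j\<in>I. \<bar>e j\<bar> \<noteq> \<infinity>" by force
  then show ?thesis
  proof cases
    case 2
    then obtain j J where j: "j \<in> J" "J \<in> \<J>" "e j = \<infinity>" using block by blast
    have "sum e J = \<infinity>" using j J by (auto simp: sum_Pinfty)
    moreover have "sum e I = \<infinity>" using 2 I by (auto simp: sum_Pinfty)
    \<comment> \<open>For positive \<open>b\<close> the block average would be infinite, against the
      bound \<open>s\<close>; for negative \<open>b\<close> the total average is minus infinity. The
      next case is the same with the signs exchanged.\<close>
    ultimately show ?thesis using 2 le[OF j(2)] cI J(3)[OF j(2)] by (cases "b > 0") auto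
  next
    case 3
    then obtain j J where j: "j \<in> J" "J \<in> \<J>" "e j = - \<infinity>" using block by blast
    have "sum e J = - \<infinity>"
      using j J(1)[OF j(2)] sub[OF j(2)] 3 by (intro sum_ereal_MInfty[of _ j]) auto
    moreover have "sum e I = - \<infinity>" using j sub 3 I by (intro sum_ereal_MInfty[of _ j]) auto
    ultimately show ?thesis using 3 le[OF j(2)] cI J(3)[OF j(2)] by (cases "b > 0") auto
  next
    case real: 4
    define r where "r j = real_of_ereal (e j)" for j
    have "sum e K = ereal (sum r K)" if "K \<subseteq> I" for K
    proof -
      have "sum e K = (\<Sum>j\<in>K. ereal (r j))"
        using real that by (intro sum.cong) (auto simp: r_def ereal_real subset_iff)
      then show ?thesis by simp
    qed
    then have e: "ereal (a * (sum x K / real (card K))) + ereal b * (sum e K / ereal (real (card K)))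
        = ereal ((\<Sum>j\<in>K. a * x j + b * r j) / real (card K))" if "K \<subseteq> I" "0 < real (card K)" for K
      using that by (simp add: sum.distrib sum_distrib_left[symmetric] add_divide_distrib)
    \<comment> \<open>Multiplying by the block size and summing over the blocks gives the convex
      combination with weights \<open>card J / card I\<close>.\<close>
    have "(\<Sum>j\<in>J. a * x j + b * r j) \<le> s * real (card J)" if "J \<in> \<J>" for J
      using le[OF that] e[OF sub[OF that] J(3)[OF that]] J(3)[OF that] by (simp add: field_simps)
    then have "(\<Sum>j\<in>I. a * x j + b * r j) \<le> (\<Sum>J\<in>\<J>. s * real (card J))"
      unfolding sumI by (intro sum_mono)
    also have "\<dots> = s * real (card I)"
      using sumI[of "\<lambda>_. 1"] by (simp add: sum_distrib_left[symmetric])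
    finally show ?thesis unfolding e[OF order_refl cI] using cI by (simp add: field_simps)
  next
    case zero: 1
    \<comment> \<open>Zero times an infinite value is zero in \<open>ereal\<close>, so for
      \<open>b = 0\<close> the integrals disappear whatever they are.\<close>
    have z: "ereal b * y = 0" for y using zero by (simp add: zero_ereal_def[symmetric])
    have "(\<Sum>j\<in>J. a * x j) \<le> s * real (card J)" if "J \<in> \<J>" for J
      using le[OF that] J(3)[OF that] by (simp add: z sum_distrib_left[symmetric] field_simps)
    then have "(\<Sum>j\<in>I. a * x j) \<le> (\<Sum>J\<in>\<J>. s * real (card J))"
      unfolding sumI by (intro sum_mono)
    also have "\<dots> = s * real (card I)"
      using sumI[of "\<lambda>_. 1"] by (simp add: sum_distrib_left[symmetric])
    finally show ?thesis using cI by (simp add: z sum_distrib_left[symmetric] field_simps)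
  qed
qed

lemma mean_restrict:
  "emp_mean Y J (restrict g J) = emp_mean Y J g"
  "avg_mean M S Z J (restrict g J) = avg_mean M S Z J g"
  by (simp_all add: emp_mean_def avg_mean_def fun_eq_iff)

text \<open>If every block supremum is below \<open>t\<close>, then, there being finitely many
  blocks, a single \<open>s\<close> strictly below \<open>t\<close> bounds them all, and hence
  bounds every average over \<open>I\<close>. The gap matters: averages that are merely below
  \<open>t\<close> could still have supremum \<open>t\<close>.\<close>

lemma sup_event_subset_blocks:
  assumes I: "finite I" "I \<noteq> {}" and part: "partition_on I \<J>"
  shows "sup_event N Y M S Z I \<G> a b t \<subseteq> (\<Union>J\<in>\<J>. sup_event N Y M S Z J (proj_tuples J \<G>) a b t)"
proof (rule subsetI, rule ccontr)
  fix \<omega> assume \<omega>: "\<omega> \<in> sup_event N Y M S Z I \<G> a b t"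
    and notin: "\<omega> \<notin> (\<Union>J\<in>\<J>. sup_event N Y M S Z J (proj_tuples J \<G>) a b t)"
  define h where "h J g = ereal (a * emp_mean Y J g \<omega>) + ereal b * avg_mean M S Z J g" for J g
  have sp: "\<omega> \<in> space N" and ge: "ereal t \<le> (SUP g\<in>\<G>. h I g)"
    using \<omega> by (auto simp: sup_event_def h_def)
  have lt: "(SUP g\<in>\<G>. h J g) < ereal t" if "J \<in> \<J>" for J
    using notin that sp
    by (auto simp: sup_event_def h_def proj_tuples_def image_image mean_restrict not_le)
  have finJ: "finite \<J>" using I(1) part by (rule finite_elements)
  have ne: "\<J> \<noteq> {}" using part I by (auto simp: partition_on_def)
  have "Max ((\<lambda>J. SUP g\<in>\<G>. h J g) ` \<J>) < ereal t"
    using finJ ne lt by (subst Max_less_iff) auto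
  from ereal_dense2[OF this] obtain s
    where s: "Max ((\<lambda>J. SUP g\<in>\<G>. h J g) ` \<J>) < ereal s" "ereal s < ereal t" by blast
  have "h J g \<le> ereal s" if "J \<in> \<J>" "g \<in> \<G>" for J g
  proof -
    have "h J g \<le> (SUP g\<in>\<G>. h J g)" using that by (intro SUP_upper)
    also have "\<dots> \<le> Max ((\<lambda>J. SUP g\<in>\<G>. h J g) ` \<J>)" using that finJ by (intro Max_ge) auto
    finally show ?thesis using s by simp
  qed
  then have "h I g \<le> ereal s" if "g \<in> \<G>" for g
    using that unfolding h_def emp_mean_def avg_mean_def
    by (intro average_le_if_block_averages_le[OF I part]) auto
  then have "(SUP g\<in>\<G>. h I g) \<le> ereal s" by (intro SUP_least)
  with ge s(2) show False by (meson leD order_trans)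
qed

section \<open>The bound for one block and the construction of the independent copy\<close>

text \<open>The event is determined by the block's values, so it is the preimage of a set in the
  product space. A measurable cover \<open>C\<close> of that set, optimal for the product measure,
  also covers it under the law of the block, and the comparison of laws applies to
  \<open>C\<close>.\<close>

lemma (in prob_space) outer_sup_event_le_product:
  assumes J: "finite J" "0 \<notin> J"
    and meas: "\<And>k. k \<in> J \<Longrightarrow> Z k \<in> M \<rightarrow>\<^sub>M borel_of (S k)"
    and L: "product_prob_space L" "\<And>k. k \<in> J \<Longrightarrow> L k = distr M (borel_of (S k)) (Z k)"
  shows "outer_measure_of M (sup_event M Z M S Z J \<H> a b t)
    \<le> outer_measure_of (Pi\<^sub>M J L) (sup_event (Pi\<^sub>M J L) (\<lambda>j y. y j) M S Z J \<H> a b t)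
       + (\<Sum>k\<in>J. beta_seq M S Z J 1 k)"
proof -
  let ?B = "\<Pi>\<^sub>M i\<in>J. borel_of (S i)" and ?X = "\<lambda>\<omega>. \<lambda>i\<in>J. Z i \<omega>"
  let ?T = "sup_event (Pi\<^sub>M J L) (\<lambda>j y. y j) M S Z J \<H> a b t"
  have X: "?X \<in> M \<rightarrow>\<^sub>M ?B" using meas by (rule measurable_restrict)
  have sets: "sets (Pi\<^sub>M J L) = sets ?B" using L(2) by (intro sets_PiM_cong) auto
  have "?T \<subseteq> space (Pi\<^sub>M J L)" by (auto simp: sup_event_def)
  from outer_measure_of_attain[OF this] obtain C
    where C: "C \<in> sets ?B" "?T \<subseteq> C" "outer_measure_of (Pi\<^sub>M J L) ?T = emeasure (Pi\<^sub>M J L) C"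
    by (auto simp: sets)
  have "sup_event M Z M S Z J \<H> a b t \<subseteq> ?X -` C \<inter> space M"
  proof
    fix \<omega> assume \<omega>: "\<omega> \<in> sup_event M Z M S Z J \<H> a b t"
    then have sp: "\<omega> \<in> space M" by (simp add: sup_event_def)
    have "?X \<omega> \<in> space (Pi\<^sub>M J L)"
      using measurable_space[OF X sp] sets_eq_imp_space_eq[OF sets] by simp
    moreover have "emp_mean (\<lambda>j y. y j) J g (?X \<omega>) = emp_mean Z J g \<omega>" for g
      by (simp add: emp_mean_def)
    ultimately have "?X \<omega> \<in> ?T" using \<omega> by (simp add: sup_event_def)
    then show "\<omega> \<in> ?X -` C \<inter> space M" using C(2) sp by auto
  qed
  then have "outer_measure_of M (sup_event M Z M S Z J \<H> a b t) \<le> emeasure M (?X -` C \<inter> space M)"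
    using outer_measure_of_mono measurable_sets[OF X C(1)] by (metis outer_measure_of_eq)
  also have "\<dots> = emeasure (distr M ?B ?X) C" by (rule emeasure_distr[OF X C(1), symmetric])
  also have "\<dots> \<le> emeasure (Pi\<^sub>M J L) C + (\<Sum>k\<in>J. beta_seq M S Z J 1 k)"
    by (rule law_le_product_plus_beta_seq[OF J meas L C(1)])
  finally show ?thesis by (simp add: C(3))
qed

theorem theorem2p11:
  fixes M :: "'w measure" and n :: nat and \<J> :: "nat set set"
    and S :: "nat \<Rightarrow> 'a topology" and Z :: "nat \<Rightarrow> 'w \<Rightarrow> 'a"
    and \<G> :: "(nat \<Rightarrow> 'a \<Rightarrow> real) set"
  assumes "prob_space M"
    and "n \<ge> 1"
    and "partition_on {1..n} \<J>"
    and "\<And>k. k \<in> {1..n} \<Longrightarrow> polish_topology (S k)"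
    and "\<And>k. k \<in> {1..n} \<Longrightarrow> Z k \<in> M \<rightarrow>\<^sub>M borel_of (S k)"
    and "\<G> \<subseteq> (\<Pi>\<^sub>E k\<in>{1..n}. borel_measurable (borel_of (S k)))"
  shows "\<exists>(N :: ('w \<times> (nat \<Rightarrow> 'a)) measure) \<pi> Zs.
      enlarges N \<pi> M \<and>
      (\<forall>k\<in>{1..n}. Zs k \<in> N \<rightarrow>\<^sub>M borel_of (S k)) \<and>
      (\<forall>k\<in>{1..n}. distr N (borel_of (S k)) (Zs k) = distr M (borel_of (S k)) (Z k)) \<and>
      (\<forall>J\<in>\<J>. prob_space.indep_vars N (\<lambda>j. borel_of (S j)) Zs J) \<and>
      (\<forall>a b t :: real.
         outer_measure_of M (sup_event M Z M S Z {1..n} \<G> a b t)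
         \<le> (\<Sum>J\<in>\<J>. outer_measure_of N (sup_event N Zs M S Z J (proj_tuples J \<G>) a b t)
                     + (\<Sum>k\<in>J. beta_seq M S Z J 1 k)))"
proof -
  interpret prob_space M by fact
  note meas = assms(5)
  let ?I = "{1..n}"
  \<comment> \<open>Outside the index range a point mass serves as a dummy, because
    \<open>product_prob_space\<close> asks for a probability measure at every index.\<close>
  define L where "L k = (if k \<in> ?I then distr M (borel_of (S k)) (Z k)
    else return (count_space UNIV) undefined)" for k
  have L: "L k = distr M (borel_of (S k)) (Z k)" if "k \<in> ?I" for k
    using that by (simp add: L_def)
  have prob_L: "prob_space (L k)" for k
    using meas by (auto simp: L_def intro!: prob_space_distr prob_space_return)
  have pps: "product_prob_space L"
    using prob_L by (simp add: product_prob_space_def product_prob_space_axioms_def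
        product_sigma_finite_def prob_space_imp_sigma_finite)
  interpret L: product_prob_space L by fact
  let ?P = "Pi\<^sub>M ?I L"
  have P: "prob_space ?P" using prob_L by (rule prob_space_PiM)
  \<comment> \<open>The first factor keeps the given variables through \<open>fst\<close>; the copy
    reads off the coordinates of the second factor, so it is independent as a whole and in
    particular on each block.\<close>
  define N where "N = M \<Otimes>\<^sub>M ?P"
  define Zs :: "nat \<Rightarrow> 'w \<times> (nat \<Rightarrow> 'a) \<Rightarrow> 'a" where "Zs k \<omega> = snd \<omega> k" for k \<omega>
  interpret P: prob_space ?P by fact
  interpret N: prob_space N unfolding N_def by (rule prob_space_pair) unfold_locales
  have I: "finite ?I" "?I \<noteq> {}" using assms(2) by auto
  have finJ: "finite \<J>" using I(1) assms(3) by (rule finite_elements)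
  have blk: "J \<subseteq> ?I" "J \<noteq> {}" "finite J" "0 \<notin> J" if "J \<in> \<J>" for J
  proof -
    show sub: "J \<subseteq> ?I" and "J \<noteq> {}" using that assms(3) by (auto simp: partition_on_def)
    show "finite J" "0 \<notin> J" using sub by (auto intro: finite_subset[OF sub])
  qed
  have distr_snd: "distr N ?P snd = ?P"
  proof -
    interpret MP: pair_sigma_finite M ?P ..
    have *: "snd \<circ> (\<lambda>(x, y). (y, x)) = fst" by (auto simp: fun_eq_iff)
    have "distr N ?P snd = distr (?P \<Otimes>\<^sub>M M) ?P (snd \<circ> (\<lambda>(x, y). (y, x)))"
      unfolding N_def by (subst MP.distr_pair_swap, subst distr_distr) auto
    then show ?thesis unfolding * distr_pair_fst .
  qed
  have Zs_meas: "Zs k \<in> N \<rightarrow>\<^sub>M borel_of (S k)" if k: "k \<in> ?I" for k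
  proof -
    have "(\<lambda>y. y k) \<in> ?P \<rightarrow>\<^sub>M L k" using k by simp
    then have "(\<lambda>\<omega>. snd \<omega> k) \<in> N \<rightarrow>\<^sub>M L k" unfolding N_def by measurable
    then show ?thesis using L[OF k] by (simp add: Zs_def[abs_def])
  qed
  have Zs_restrict: "distr N (\<Pi>\<^sub>M j\<in>J. borel_of (S j)) (\<lambda>\<omega>. \<lambda>j\<in>J. Zs j \<omega>) = Pi\<^sub>M J L" if "J \<subseteq> ?I" for J
  proof -
    have m: "(\<lambda>y. restrict y J) \<in> ?P \<rightarrow>\<^sub>M Pi\<^sub>M J L" by (rule measurable_restrict_subset[OF that])
    have "distr N (\<Pi>\<^sub>M j\<in>J. borel_of (S j)) (\<lambda>\<omega>. \<lambda>j\<in>J. Zs j \<omega>) = distr N (Pi\<^sub>M J L) ((\<lambda>y. restrict y J) \<circ> snd)"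
      using that L by (intro distr_cong sets_PiM_cong) (auto simp: Zs_def)
    also have "\<dots> = distr (distr N ?P snd) (Pi\<^sub>M J L) (\<lambda>y. restrict y J)"
      by (intro distr_distr[symmetric] m) (simp add: N_def)
    also have "\<dots> = Pi\<^sub>M J L"
      unfolding distr_snd using L.distr_restrict[OF that I(1)] by simp
    finally show ?thesis .
  qed
  have Zs_law: "distr N (borel_of (S k)) (Zs k) = L k" if k: "k \<in> ?I" for k
  proof -
    have "distr N (borel_of (S k)) (Zs k) = distr N (L k) ((\<lambda>y. y k) \<circ> snd)"
      using L[OF k] by (intro distr_cong) (auto simp: Zs_def)
    also have "\<dots> = distr (distr N ?P snd) (L k) (\<lambda>y. y k)"
      using k by (intro distr_distr[symmetric]) (auto simp: N_def)
    also have "\<dots> = L k" unfolding distr_snd using k by (intro distr_PiM_component) (auto intro: prob_L)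
    finally show ?thesis .
  qed
  have block: "outer_measure_of M (sup_event M Z M S Z J \<H> a b t)
      \<le> outer_measure_of N (sup_event N Zs M S Z J \<H> a b t) + (\<Sum>k\<in>J. beta_seq M S Z J 1 k)"
    if "J \<in> \<J>" for J \<H> a b t
  proof -
    let ?T = "sup_event (Pi\<^sub>M J L) (\<lambda>j y. y j) M S Z J \<H> a b t"
    note J = blk[OF that]
    have T: "?T \<subseteq> space (Pi\<^sub>M J L)" by (auto simp: sup_event_def)
    \<comment> \<open>From the block product to the full product and then to \<open>N\<close>: each
      step passes to a cylinder, which does not lower the outer measure.\<close>
    have "outer_measure_of (Pi\<^sub>M J L) ?T \<le> outer_measure_of ?P (prod_emb ?I L J ?T)"
      using I(1) J(1) T by (rule L.outer_measure_of_PiM_prod_emb)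
    also have "\<dots> \<le> outer_measure_of N (space M \<times> prod_emb ?I L J ?T)"
      unfolding N_def using prob_space_axioms P
      by (rule outer_measure_of_pair_snd) (auto simp: prod_emb_def space_PiM)
    \<comment> \<open>The cylinder lies inside the event, since the empirical mean over
      \<open>J\<close> sees only the coordinates in \<open>J\<close>.\<close>
    also have "\<dots> \<le> outer_measure_of N (sup_event N Zs M S Z J \<H> a b t)"
      by (intro outer_measure_of_mono)
        (auto simp: sup_event_def prod_emb_def N_def space_pair_measure space_PiM emp_mean_def Zs_def)
    finally have "outer_measure_of (Pi\<^sub>M J L) ?T \<le> outer_measure_of N (sup_event N Zs M S Z J \<H> a b t)" .
    moreover have "outer_measure_of M (sup_event M Z M S Z J \<H> a b t)
        \<le> outer_measure_of (Pi\<^sub>M J L) ?T + (\<Sum>k\<in>J. beta_seq M S Z J 1 k)"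
      using J meas L by (intro outer_sup_event_le_product pps) auto
    ultimately show ?thesis by (meson add_right_mono order_trans)
  qed
  show ?thesis
  proof (intro exI[of _ N] exI[of _ fst] exI[of _ Zs] conjI ballI allI)
    show "enlarges N fst M"
      unfolding enlarges_def using N.prob_space_axioms P.distr_pair_fst[of M] by (simp add: N_def)
    show "Zs k \<in> N \<rightarrow>\<^sub>M borel_of (S k)" if "k \<in> ?I" for k by (rule Zs_meas[OF that])
    show "distr N (borel_of (S k)) (Zs k) = distr M (borel_of (S k)) (Z k)" if "k \<in> ?I" for k
      using Zs_law L that by simp
    show "N.indep_vars (\<lambda>j. borel_of (S j)) Zs J" if "J \<in> \<J>" for J
    \<comment> \<open>Independence is read off from the joint law being the product of the
      marginals; this criterion wants a nonempty index set, which the partition provides.\<close>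
    proof (subst N.indep_vars_iff_distr_eq_PiM')
      show "distr N (\<Pi>\<^sub>M j\<in>J. borel_of (S j)) (\<lambda>\<omega>. \<lambda>j\<in>J. Zs j \<omega>)
          = (\<Pi>\<^sub>M j\<in>J. distr N (borel_of (S j)) (Zs j))"
        unfolding Zs_restrict[OF blk(1)[OF that]]
        using blk(1)[OF that] by (intro PiM_cong) (auto simp: Zs_law subset_iff)
    qed (use blk(1,2)[OF that] Zs_meas in auto)
    fix a b t
    have "outer_measure_of M (sup_event M Z M S Z ?I \<G> a b t)
        \<le> outer_measure_of M (\<Union>J\<in>\<J>. sup_event M Z M S Z J (proj_tuples J \<G>) a b t)"
      by (intro outer_measure_of_mono sup_event_subset_blocks I assms(3))
    also have "\<dots> \<le> (\<Sum>J\<in>\<J>. outer_measure_of M (sup_event M Z M S Z J (proj_tuples J \<G>) a b t))"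
      by (intro outer_measure_of_UN_le finJ) (auto simp: sup_event_def)
    also have "\<dots> \<le> (\<Sum>J\<in>\<J>. outer_measure_of N (sup_event N Zs M S Z J (proj_tuples J \<G>) a b t)
        + (\<Sum>k\<in>J. beta_seq M S Z J 1 k))"
      by (intro sum_mono block)
    finally show "outer_measure_of M (sup_event M Z M S Z ?I \<G> a b t)
        \<le> (\<Sum>J\<in>\<J>. outer_measure_of N (sup_event N Zs M S Z J (proj_tuples J \<G>) a b t)
                     + (\<Sum>k\<in>J. beta_seq M S Z J 1 k))" .
  qed
qed

end
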